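(* Let $\rho:[0,+\infty)\to\mathbb{R}$ be convex and satisfy: (AS1) $\rho(0)=0$, $\rho(s)<+\infty$ for all $s<+\infty$, and $0$ is the strict minimizer of $\rho$; (AS2) $\rho$ is increasing on $[0,+\infty)$. Let $\alpha>0$, let $A$ be a real $K\times N$ matrix, let $\tilde u\in\mathbb{R}^N$ and $f=A\tilde u$. If $\tilde u$ is a global minimizer over $u\in\mathbb{R}^N$ of $$E(u)=\sum_{1\le i\le N}\rho(|(\nabla_x u)_i|)+\frac{\alpha}{2}\|Au-f\|_{\mathbb{R}^K}^2,$$ then $\tilde u$ is a constant signal, i.e., $\tilde u=c(1,1,\dots,1)\in\mathbb{R}^N$ for some $c\in\mathbb{R}$.
   Context: "Increasing" is meant in the non-strict sense. $\nabla_x$ is the forward difference operator, $(\nabla_x u)_i=u_{i+1}-u_i$ for $1\le i\le N-1$, with a boundary condition at $i=N$, e.g. periodic ($(\nabla_x u)_N=u_1-u_N$) or Neumann ($(\nabla_x u)_N=0$). $\|\cdot\|_{\mathbb{R}^K}$ is the Euclidean norm. *)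

theory Defs
  imports
    "HOL-Analysis.Convex"
    "HOL-Analysis.L2_Norm"
    "Jordan_Normal_Form.Matrix"
begin

text \<open>
  Signals are real vectors, indexed from \<open>0\<close> to \<open>N - 1\<close>. The last entry of the
  forward difference is set by a boundary condition, which is taken to be homogeneous and linear,
  so that the difference operator is linear. The coefficient vector \<open>b\<close> encodes it:
  the last entry is the scalar product of \<open>b\<close> and the signal.
\<close>

definition forward_diff :: "real vec \<Rightarrow> real vec \<Rightarrow> real vec" where
  "forward_diff b u = vec (dim_vec u)
     (\<lambda>i. if i + 1 < dim_vec u then u $ (i + 1) - u $ i else scalar_prod b u)"

definition periodic_bc :: "nat \<Rightarrow> real vec" where
  "periodic_bc N = unit_vec N 0 - unit_vec N (N - 1)"

definition neumann_bc :: "nat \<Rightarrow> real vec" where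
  "neumann_bc N = 0\<^sub>v N"

lemma bc_carrier: "periodic_bc N \<in> carrier_vec N" "neumann_bc N \<in> carrier_vec N"
  by (simp_all add: periodic_bc_def neumann_bc_def)

lemma forward_diff_periodic_last:
  assumes "u \<in> carrier_vec N" "0 < N"
  shows "forward_diff (periodic_bc N) u $ (N - 1) = u $ 0 - u $ (N - 1)"
  using assms
  by (simp add: forward_diff_def periodic_bc_def minus_scalar_prod_distrib[of _ N])

lemma forward_diff_neumann_last:
  assumes "u \<in> carrier_vec N" "0 < N"
  shows "forward_diff (neumann_bc N) u $ (N - 1) = 0"
  using assms by (simp add: forward_diff_def neumann_bc_def)

definition euclidean_norm :: "real vec \<Rightarrow> real" where
  "euclidean_norm v = L2_set (\<lambda>i. v $ i) {0..<dim_vec v}"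

definition energy ::
  "(real \<Rightarrow> real) \<Rightarrow> real vec \<Rightarrow> real \<Rightarrow> real mat \<Rightarrow> real vec \<Rightarrow> real vec \<Rightarrow> real" where
  "energy \<rho> b \<alpha> A f u =
     (\<Sum>i = 0..<dim_vec u. \<rho> \<bar>forward_diff b u $ i\<bar>)
     + \<alpha> / 2 * (euclidean_norm (A *\<^sub>v u - f))\<^sup>2"

end

theory Submission
  imports Defs
begin

text \<open>
  Shrink the minimizer to \<open>(1 - s) \<cdot> ut\<close>. Convexity and \<open>\<rho> 0 = 0\<close> make the regularization term
  drop by at least \<open>s\<close> times its value, while the data term, which vanishes at \<open>ut\<close>,
  only grows like \<open>s\<^sup>2\<close>. Letting \<open>s\<close> tend to \<open>0\<close>, the regularization term of \<open>ut\<close> is zero.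
\<close>

text \<open>The boundary condition is homogeneous and linear, so the last entry scales like the
  interior differences.\<close>

lemma forward_diff_smult:
  assumes "b \<in> carrier_vec N" "u \<in> carrier_vec N" "i < N"
  shows "forward_diff b (t \<cdot>\<^sub>v u) $ i = t * forward_diff b u $ i"
  using assms by (simp add: forward_diff_def algebra_simps)

lemma euclidean_norm_smult:
  "euclidean_norm (t \<cdot>\<^sub>v v) = \<bar>t\<bar> * euclidean_norm v"
proof -
  have "L2_set (\<lambda>i. (t \<cdot>\<^sub>v v) $ i) {0..<dim_vec v} = L2_set (\<lambda>i. \<bar>t\<bar> * v $ i) {0..<dim_vec v}"
    by (simp add: L2_set_def power_mult_distrib)
  then show ?thesis
    by (simp add: euclidean_norm_def L2_set_right_distrib)
qed

text \<open>Convexity between \<open>0\<close> and \<open>x\<close> with weights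
  \<open>1 - t\<close> and \<open>t\<close>; the endpoint \<open>0\<close> contributes
  nothing.\<close>

lemma convex_on_shrink_le:
  fixes \<rho> :: "real \<Rightarrow> real"
  assumes "convex_on {0..} \<rho>" "\<rho> 0 = 0" "0 \<le> t" "t \<le> 1" "0 \<le> x"
  shows "\<rho> (t * x) \<le> t * \<rho> x"
  using convex_onD[OF assms(1), of t 0 x] assms(2-) by simp

lemma nonpos_if_le_mult_small:
  fixes S C :: real
  assumes "0 \<le> C" and le: "\<And>s. \<lbrakk>0 < s; s \<le> 1\<rbrakk> \<Longrightarrow> S \<le> s * C"
  shows "S \<le> 0"
proof (rule ccontr)
  assume "\<not> S \<le> 0"
  then have "0 < S" by simp
  \<comment> \<open>An explicit \<open>s\<close> replaces the limit: \<open>S / (S + C)\<close> lies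
    in (0, 1], and the resulting bound is below \<open>S\<close> because C < S + C.\<close>
  then have "S \<le> S / (S + C) * C"
    using \<open>0 \<le> C\<close> by (intro le) auto
  then show False
    using \<open>0 < S\<close> \<open>0 \<le> C\<close> by (simp add: field_simps mult_le_0_iff)
qed

text \<open>The differences with \<open>i + 1 < N\<close> carry the value \<open>u $ 0\<close> along
  the signal. For \<open>N = 0\<close> the entry \<open>u $ 0\<close> is unspecified, but both sides
  are the empty vector.\<close>

lemma constant_if_forward_diff_zero:
  assumes u: "u \<in> carrier_vec N" and zero: "\<And>i. i < N \<Longrightarrow> forward_diff b u $ i = 0"
  shows "u = u $ 0 \<cdot>\<^sub>v vec N (\<lambda>_. 1)"
proof -
  have const: "i < N \<Longrightarrow> u $ i = u $ 0" for i
  proof (induction i)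
    case (Suc i)
    then show ?case
      using zero[of i] u by (simp add: forward_diff_def)
  qed simp
  show ?thesis
  proof (rule eq_vecI)
    fix i
    assume "i < dim_vec (u $ 0 \<cdot>\<^sub>v vec N (\<lambda>_. 1))"
    then have "i < N" by simp
    then show "u $ i = (u $ 0 \<cdot>\<^sub>v vec N (\<lambda>_. 1)) $ i"
      using const[of i] by simp
  qed (use u in simp)
qed

theorem proposition4p1:
  fixes \<rho> :: "real \<Rightarrow> real" and \<alpha> :: real and K N :: nat
    and A :: "real mat" and b f ut :: "real vec"
  assumes convex: "convex_on {0..} \<rho>"
    and AS1: "\<rho> 0 = 0" "\<And>s. 0 < s \<Longrightarrow> \<rho> 0 < \<rho> s"
    and AS2: "mono_on {0..} \<rho>"
    and alpha: "0 < \<alpha>"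
    and A: "A \<in> carrier_mat K N"
    and b: "b \<in> carrier_vec N"
    and ut: "ut \<in> carrier_vec N"
    and f: "f = A *\<^sub>v ut"
    and minimizer: "\<forall>u \<in> carrier_vec N. energy \<rho> b \<alpha> A f ut \<le> energy \<rho> b \<alpha> A f u"
  shows "\<exists>c. ut = c \<cdot>\<^sub>v vec N (\<lambda>_. 1)"
proof -
  define d where "d i = forward_diff b ut $ i" for i
  define S where "S = (\<Sum>i = 0..<N. \<rho> \<bar>d i\<bar>)"
  define C where "C = \<alpha> / 2 * (euclidean_norm f)\<^sup>2"
  have fK: "f \<in> carrier_vec K"
    using f A ut by simp
  have residual: "A *\<^sub>v (t \<cdot>\<^sub>v ut) - f = (t - 1) \<cdot>\<^sub>v f" for t
    using fK mult_mat_vec[OF A ut, of t] unfolding f[symmetric]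
    by (intro eq_vecI) (auto simp: algebra_simps)
  \<comment> \<open>On this line the data term is exactly quadratic, and \<open>C\<close> is its
    value at the zero signal. The minimizer is \<open>t = 1\<close>, its competitor
    \<open>t = 1 - s\<close>.\<close>
  have energy_scaled: "energy \<rho> b \<alpha> A f (t \<cdot>\<^sub>v ut) = (\<Sum>i = 0..<N. \<rho> (\<bar>t\<bar> * \<bar>d i\<bar>)) + (t - 1)\<^sup>2 * C"
    for t
    using ut forward_diff_smult[OF b ut]
    by (simp add: energy_def residual euclidean_norm_smult power_mult_distrib C_def d_def abs_mult)
  have "S \<le> s * C" if s: "0 < s" "s \<le> 1" for s
  proof -
    have "S = energy \<rho> b \<alpha> A f ut"
      using energy_scaled[of 1] by (simp add: S_def)
    also have "\<dots> \<le> energy \<rho> b \<alpha> A f ((1 - s) \<cdot>\<^sub>v ut)"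
      using minimizer ut by simp
    also have "\<dots> = (\<Sum>i = 0..<N. \<rho> ((1 - s) * \<bar>d i\<bar>)) + s\<^sup>2 * C"
      using s by (simp add: energy_scaled)
    also have "\<dots> \<le> (1 - s) * S + s\<^sup>2 * C"
      unfolding S_def sum_distrib_left
      using s by (intro add_right_mono sum_mono convex_on_shrink_le[OF convex AS1(1)]) auto
    \<comment> \<open>\<open>S\<close> cancels on both sides; the common factor \<open>s\<close> is
      positive and can be divided out.\<close>
    finally have "s * S \<le> s * (s * C)"
      by (simp add: algebra_simps power2_eq_square)
    then show ?thesis
      using s by simp
  qed
  then have "S \<le> 0"
    using alpha by (intro nonpos_if_le_mult_small[of C S]) (auto simp: C_def)
  moreover have nonneg: "0 \<le> \<rho> \<bar>x\<bar>" for x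
    using AS1(1) AS1(2)[of "\<bar>x\<bar>"] by (cases "x = 0") auto
  moreover have "0 \<le> S"
    unfolding S_def by (rule sum_nonneg) (rule nonneg)
  ultimately have "S = 0" by simp
  then have "\<rho> \<bar>d i\<bar> = 0" if "i < N" for i
    using that nonneg by (simp add: S_def sum_nonneg_eq_0_iff)
  \<comment> \<open>Strictness of the minimizer \<open>0\<close> excludes a nonzero
    difference.\<close>
  then have "d i = 0" if "i < N" for i
    using that AS1(1) AS1(2)[of "\<bar>d i\<bar>"] by (cases "d i = 0") auto
  then show ?thesis
    unfolding d_def by (intro exI) (rule constant_if_forward_diff_zero[OF ut])
qed

end
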